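(* Let $S$ be a semigroup and let $e\in S$. Then $\mathbf{RG}(e)\neq\emptyset$ if and only if $e$ is an idempotent. In this case, $\mathbf{RG}(e)=\mathbf{H}(e)\mathbf{RZ}(e)$ is the maximum right subgroup of $S$ containing $e$.
   Context: For $e\in S$, $\mathbf{RZ}(e)=\{b\in S\mid be=e \text{ and } eb=b\}$. For an idempotent $e$, $\mathbf{H}(e)$ is the maximum subgroup of $S$ containing $e$, i.e. the group of units of the monoid $eSe$ with identity $e$. For $e \in S$, $\mathbf{RG}(e)=\mathbf{H}(e)\mathbf{RZ}(e)=\{xy\mid x\in\mathbf{H}(e),\,y\in\mathbf{RZ}(e)\}$, with the convention that this is $\emptyset$ when $\mathbf{RZ}(e)=\emptyset$. A right group is a semigroup that is left cancellative ($ax=ay$ implies $x=y$) and right simple ($aR=R$ for all $a$ in the semigroup $R$); a right subgroup of $S$ is a subsemigroup of $S$ that is a right group. "Maximum" is with respect to inclusion: it is itself a right subgroup containing $e$ and contains every right subgroup of $S$ containing $e$. *)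

theory Defs
  imports "HOL-Algebra.Group"
begin

definition RZ :: "'a::semigroup_mult \<Rightarrow> 'a set" where
  "RZ e = {b. b * e = e \<and> e * b = b}"

definition local_monoid :: "'a::semigroup_mult \<Rightarrow> 'a monoid" where
  "local_monoid e = \<lparr>carrier = {e * s * e | s. True}, monoid.mult = (*), one = e\<rparr>"

text \<open>
  Meaningful for idempotent \<open>e\<close> only: then \<open>local_monoid e\<close> is a monoid, and its units
  form the maximum subgroup containing \<open>e\<close> (see \<open>max_subgroup_greatest\<close> below).
\<close>

definition max_subgroup :: "'a::semigroup_mult \<Rightarrow> 'a set" where
  "max_subgroup e = Units (local_monoid e)"

text \<open>
  If \<open>e\<close> is not idempotent then \<open>RZ e\<close> is empty, so the junk value of
  \<open>max_subgroup e\<close> does not matter here.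
\<close>

definition RG :: "'a::semigroup_mult \<Rightarrow> 'a set" where
  "RG e = (if RZ e = {} then {} else {x * y | x y. x \<in> max_subgroup e \<and> y \<in> RZ e})"

definition subsemigroup :: "'a::semigroup_mult set \<Rightarrow> bool" where
  "subsemigroup R \<longleftrightarrow> (\<forall>x\<in>R. \<forall>y\<in>R. x * y \<in> R)"

definition left_cancellative_on :: "'a::semigroup_mult set \<Rightarrow> bool" where
  "left_cancellative_on R \<longleftrightarrow> (\<forall>a\<in>R. \<forall>x\<in>R. \<forall>y\<in>R. a * x = a * y \<longrightarrow> x = y)"

definition right_simple_on :: "'a::semigroup_mult set \<Rightarrow> bool" where
  "right_simple_on R \<longleftrightarrow> (\<forall>a\<in>R. (\<lambda>x. a * x) ` R = R)"

text \<open>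
  The empty set is not excluded; this is harmless wherever membership of a given element
  is also required.
\<close>

definition right_subgroup :: "'a::semigroup_mult set \<Rightarrow> bool" where
  "right_subgroup R \<longleftrightarrow> subsemigroup R \<and> left_cancellative_on R \<and> right_simple_on R"

lemma local_monoid_simps [simp]:
  "carrier (local_monoid e) = {e * s * e | s. True}"
  "monoid.mult (local_monoid e) = (*)"
  "one (local_monoid e) = e"
  by (simp_all add: local_monoid_def)

lemma monoid_local_monoid:
  fixes e :: "'a::semigroup_mult"
  assumes "e * e = e"
  shows "monoid (local_monoid e)"
proof (rule monoidI)
  fix x y assume "x \<in> carrier (local_monoid e)" "y \<in> carrier (local_monoid e)"
  then obtain s t where "x = e * s * e" "y = e * t * e" by auto
  then have "x * y = e * (s * e * e * t) * e" by (simp add: mult.assoc)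
  then show "x \<otimes>\<^bsub>local_monoid e\<^esub> y \<in> carrier (local_monoid e)" by auto
next
  have "e = e * e * e" using assms by simp
  then show "\<one>\<^bsub>local_monoid e\<^esub> \<in> carrier (local_monoid e)" by auto
next
  fix x assume "x \<in> carrier (local_monoid e)"
  then obtain s where x: "x = e * s * e" by auto
  show "\<one>\<^bsub>local_monoid e\<^esub> \<otimes>\<^bsub>local_monoid e\<^esub> x = x"
    using assms by (simp add: x mult.assoc[symmetric])
  show "x \<otimes>\<^bsub>local_monoid e\<^esub> \<one>\<^bsub>local_monoid e\<^esub> = x"
    using assms by (simp add: x mult.assoc)
qed (simp add: mult.assoc)

text \<open>
  A subgroup of the semigroup is a subset that is a group under the restricted operation,
  with whatever identity \<open>f\<close> it may have.
\<close>

lemma max_subgroup_greatest: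
  fixes e :: "'a::semigroup_mult"
  assumes "e * e = e"
  shows "group \<lparr>carrier = max_subgroup e, monoid.mult = (*), one = e\<rparr>"
    and "e \<in> max_subgroup e"
    and "group \<lparr>carrier = G, monoid.mult = (*), one = f\<rparr> \<Longrightarrow> e \<in> G \<Longrightarrow> G \<subseteq> max_subgroup e"
proof -
  interpret M: monoid "local_monoid e" by (rule monoid_local_monoid[OF assms])
  show "group \<lparr>carrier = max_subgroup e, monoid.mult = (*), one = e\<rparr>"
    using M.units_group by (simp add: units_of_def max_subgroup_def)
  show "e \<in> max_subgroup e"
    using M.Units_one_closed by (simp add: max_subgroup_def)
  assume "group \<lparr>carrier = G, monoid.mult = (*), one = f\<rparr>" and eG: "e \<in> G"
  then interpret G: group "\<lparr>carrier = G, monoid.mult = (*), one = f\<rparr>" by simp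
  have ef: "e = f"
    using G.l_cancel_one[of e e] eG assms by simp
  show "G \<subseteq> max_subgroup e"
  proof
    fix x assume x: "x \<in> G"
    then obtain y where y: "y \<in> G" "y * x = e" "x * y = e"
      using G.l_inv_ex[of x] G.r_inv_ex[of x] G.inv_closed[of x] G.l_inv[of x] G.r_inv[of x] ef
      by auto
    have "z = e * z * e" if "z \<in> G" for z
      using G.l_one[of z] G.r_one[of z] that ef by simp
    then have "x \<in> carrier (local_monoid e)" "y \<in> carrier (local_monoid e)"
      using x y(1) by auto
    then show "x \<in> max_subgroup e"
      unfolding max_subgroup_def Units_def using y(2,3) by auto
  qed
qed

end

theory Submission
  imports Defs
begin

text \<open>
  The product \<open>R\<close> of \<open>H(e)\<close> and \<open>RZ(e)\<close> consists of the \<open>z\<close> with \<open>e z = z\<close> and \<open>z e \<in> H(e)\<close>: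
  the factorisation is recovered as \<open>x = z e\<close> and \<open>y = (z e)\<^sup>-\<^sup>1 z\<close>. Since \<open>a z = (a e) z\<close> on \<open>R\<close>,
  left multiplication by \<open>a\<close> is left multiplication by a unit, hence bijective on \<open>R\<close>.
\<close>

text \<open>Any \<open>b\<close> in \<open>RZ e\<close> gives
  \<open>e * e = e * (b * e) = (e * b) * e = b * e = e\<close>; conversely, an idempotent
  \<open>e\<close> is its own witness.\<close>

lemma RZ_nonempty_iff:
  fixes e :: "'a::semigroup_mult"
  shows "RZ e \<noteq> {} \<longleftrightarrow> e * e = e"
proof
  assume "RZ e \<noteq> {}"
  then obtain b where b: "b * e = e" "e * b = b" by (auto simp: RZ_def)
  then show "e * e = e" by (metis mult.assoc)
qed (auto simp: RZ_def)

text \<open>For idempotent \<open>e\<close>, lying in \<open>eSe\<close> amounts to being fixed by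
  \<open>e\<close> on both sides, so being a unit of the local monoid becomes purely
  equational.\<close>

lemma mem_max_subgroup_iff:
  fixes e :: "'a::semigroup_mult"
  assumes "e * e = e"
  shows "x \<in> max_subgroup e \<longleftrightarrow>
    e * x = x \<and> x * e = x \<and> (\<exists>y. e * y = y \<and> y * e = y \<and> x * y = e \<and> y * x = e)"
proof -
  have mem: "z \<in> carrier (local_monoid e) \<longleftrightarrow> e * z = z \<and> z * e = z" for z
  proof
    assume "z \<in> carrier (local_monoid e)"
    then obtain s where "z = e * s * e" by auto
    then show "e * z = z \<and> z * e = z"
      by (metis assms mult.assoc)
  next
    assume "e * z = z \<and> z * e = z"
    then have "z = e * z * e" by simp
    then show "z \<in> carrier (local_monoid e)" by auto
  qed
  show ?thesis
    unfolding max_subgroup_def Units_def mem_Collect_eq Bex_def mem by auto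
qed

lemma RG_eq:
  fixes e :: "'a::semigroup_mult"
  assumes "e * e = e"
  shows "RG e = {x * y | x y. x \<in> max_subgroup e \<and> y \<in> RZ e}"
  using assms RZ_nonempty_iff[of e] by (simp add: RG_def)

lemma mem_RG_iff:
  fixes e :: "'a::semigroup_mult"
  assumes "e * e = e"
  shows "z \<in> RG e \<longleftrightarrow> e * z = z \<and> z * e \<in> max_subgroup e"
proof
  assume "z \<in> RG e"
  then obtain x y where z: "z = x * y" and x: "x \<in> max_subgroup e" and y: "y * e = e"
    by (auto simp: RG_eq[OF assms] RZ_def)
  have ex: "e * x = x" "x * e = x"
    using x by (auto simp: mem_max_subgroup_iff[OF assms])
  have "e * z = z" by (simp add: z ex mult.assoc[symmetric])
  moreover have "z * e = x" by (simp add: z y ex mult.assoc)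
  ultimately show "e * z = z \<and> z * e \<in> max_subgroup e" using x by simp
next
  assume z: "e * z = z \<and> z * e \<in> max_subgroup e"
  then obtain x' where x': "e * x' = x'" "z * e * x' = e" "x' * (z * e) = e"
    by (auto simp: mem_max_subgroup_iff[OF assms])
  have "x' * z \<in> RZ e"
    using x' by (simp add: RZ_def mult.assoc) (simp add: mult.assoc[symmetric])
  moreover have "z = (z * e) * (x' * z)"
    using z x' by (simp add: mult.assoc[symmetric])
  ultimately show "z \<in> RG e"
    using z by (auto simp: RG_eq[OF assms])
qed

lemma mult_mem_max_subgroup:
  fixes e :: "'a::semigroup_mult"
  assumes "e * e = e" "x \<in> max_subgroup e" "y \<in> max_subgroup e"
  shows "x * y \<in> max_subgroup e"
  using group.is_monoid[OF max_subgroup_greatest(1)[OF assms(1)]]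
    monoid.m_closed[of "\<lparr>carrier = max_subgroup e, monoid.mult = (*), one = e\<rparr>" x y] assms
  by simp

text \<open>Here \<open>i\<close> is the group inverse of \<open>a * e\<close>. Since
  \<open>e * i = i\<close>, it is a right inverse of \<open>a\<close> itself; on the left it inverts
  \<open>a\<close> only up to a factor \<open>e\<close>, which is enough because \<open>e\<close> is
  a left identity on \<open>RG e\<close>.\<close>

lemma RG_inverse:
  fixes e :: "'a::semigroup_mult"
  assumes idem: "e * e = e" and "a \<in> RG e"
  obtains i where "i \<in> max_subgroup e" "a * i = e" "i * a * e = e"
proof -
  have "a * e \<in> max_subgroup e"
    using assms by (simp add: mem_RG_iff)
  then obtain i where i: "e * i = i" "i * e = i" "a * e * i = e" "i * (a * e) = e"
    and ae: "e * (a * e) = a * e" "a * e * e = a * e"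
    by (auto simp: mem_max_subgroup_iff[OF idem])
  show thesis
  proof
    show "i \<in> max_subgroup e"
      using i ae by (auto simp: mem_max_subgroup_iff[OF idem])
    show "a * i = e" using i by (metis mult.assoc)
    show "i * a * e = e" using i by (simp add: mult.assoc)
  qed
qed

lemma right_subgroup_RG:
  fixes e :: "'a::semigroup_mult"
  assumes idem: "e * e = e"
  shows "right_subgroup (RG e)"
proof -
  have left_id: "e * x = x" if "x \<in> RG e" for x
    using that by (simp add: mem_RG_iff[OF idem])
  have closed: "x * y \<in> RG e" if "x \<in> RG e" "y \<in> RG e" for x y
  proof -
    \<comment> \<open>By \<open>e * y = y\<close>, the map sending \<open>z\<close> to
      \<open>z * e\<close> is a homomorphism from \<open>RG e\<close> into the group, so closure is
      inherited from there.\<close>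
    have "x * y * e = (x * e) * (y * e)"
      using left_id[OF that(2)] by (metis mult.assoc)
    moreover have "e * (x * y) = x * y"
      using left_id[OF that(1)] by (simp add: mult.assoc[symmetric])
    ultimately show ?thesis
      using that by (simp add: mem_RG_iff[OF idem] mult_mem_max_subgroup[OF idem])
  qed
  have H_sub: "i \<in> RG e" if "i \<in> max_subgroup e" for i
    using that by (auto simp: mem_RG_iff[OF idem] mem_max_subgroup_iff[OF idem])
  have "left_cancellative_on (RG e)"
    unfolding left_cancellative_on_def
  proof (intro ballI impI)
    fix a x y assume a: "a \<in> RG e" and x: "x \<in> RG e" and y: "y \<in> RG e" and eq: "a * x = a * y"
    obtain i where i: "i \<in> max_subgroup e" "a * i = e" "i * a * e = e"
      by (rule RG_inverse[OF idem a])
    \<comment> \<open>Insert \<open>e\<close> in front of \<open>z\<close>: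
      \<open>i * a * z = i * a * e * z = e * z = z\<close>.\<close>
    have *: "i * (a * z) = z" if "z \<in> RG e" for z
      using i(3) left_id[OF that] by (metis mult.assoc)
    show "x = y" using *[OF x] *[OF y] eq by metis
  qed
  moreover have "right_simple_on (RG e)"
    unfolding right_simple_on_def
  proof (intro ballI equalityI subsetI)
    fix a w assume a: "a \<in> RG e" and w: "w \<in> RG e"
    obtain i where i: "i \<in> max_subgroup e" "a * i = e" "i * a * e = e"
      by (rule RG_inverse[OF idem a])
    have "w = a * (i * w)" using i(2) left_id[OF w] by (simp add: mult.assoc[symmetric])
    then show "w \<in> (\<lambda>x. a * x) ` RG e" using closed[OF H_sub[OF i(1)] w] by blast
  qed (auto intro: closed)
  ultimately show ?thesis
    using closed by (simp add: right_subgroup_def subsemigroup_def)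
qed

lemma right_subgroup_subset_RG:
  fixes e :: "'a::semigroup_mult"
  assumes idem: "e * e = e" and R: "right_subgroup R" and e: "e \<in> R"
  shows "R \<subseteq> RG e"
proof
  fix x assume x: "x \<in> R"
  have closed: "a * b \<in> R" if "a \<in> R" "b \<in> R" for a b
    using R that by (simp add: right_subgroup_def subsemigroup_def)
  have cancel: "b = c" if "a * b = a * c" "a \<in> R" "b \<in> R" "c \<in> R" for a b c
    using R that by (auto simp: right_subgroup_def left_cancellative_on_def)
  have solve: "\<exists>c\<in>R. b = a * c" if "a \<in> R" "b \<in> R" for a b
    using R that by (auto simp: right_subgroup_def right_simple_on_def)
  \<comment> \<open>Cancel the idempotent \<open>e\<close> on the left of
    \<open>e * (e * a) = e * a\<close>.\<close>
  have left_id: "e * a = a" if "a \<in> R" for a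
    using cancel[of e "e * a" a] idem e that closed by (simp add: mult.assoc[symmetric])
  have xe: "x * e \<in> R" using closed x e .
  obtain y where y: "y \<in> R" "x * e * y = e" using solve[OF xe e] by metis
  \<comment> \<open>The right inverse \<open>y\<close> from right simplicity is also a left inverse:
    both sides equal \<open>x * e\<close>, and cancelling \<open>x * e\<close> leaves
    \<open>y * (x * e) = e\<close>.\<close>
  have "x * e * (y * (x * e)) = x * e * e"
    using y left_id[OF xe] idem by (metis mult.assoc)
  then have yx: "y * (x * e) = e"
    using cancel xe y e closed by blast
  \<comment> \<open>Right multiplication by \<open>e\<close> need not fix \<open>y\<close>, so
    \<open>y * e\<close>, which lies in \<open>eSe\<close>, serves as the inverse of
    \<open>x * e\<close>.\<close>
  have "x * e * (y * e) = e" using y idem by (metis mult.assoc)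
  moreover have "y * e * (x * e) = e" using yx left_id[OF x] by (metis mult.assoc)
  moreover have "e * (y * e) = y * e" using left_id closed y e by blast
  moreover have "z * e * e = z * e" for z using idem by (simp add: mult.assoc)
  ultimately have "x * e \<in> max_subgroup e"
    using left_id[OF xe] by (auto simp: mem_max_subgroup_iff[OF idem])
  then show "x \<in> RG e" using left_id[OF x] by (simp add: mem_RG_iff[OF idem])
qed

theorem proposition5p2:
  fixes e :: "'a::semigroup_mult"
  shows "(RG e \<noteq> {} \<longleftrightarrow> e * e = e) \<and>
    (e * e = e \<longrightarrow>
      RG e = {x * y | x y. x \<in> max_subgroup e \<and> y \<in> RZ e} \<and>
      right_subgroup (RG e) \<and> e \<in> RG e \<and>
      (\<forall>R. right_subgroup R \<and> e \<in> R \<longrightarrow> R \<subseteq> RG e))"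
proof -
  have "e \<in> RG e" if "e * e = e"
    using that max_subgroup_greatest(2) by (simp add: mem_RG_iff)
  moreover have "e * e = e" if "RG e \<noteq> {}"
    using that RZ_nonempty_iff[of e] by (auto simp: RG_def split: if_splits)
  ultimately show ?thesis
    using RG_eq right_subgroup_RG right_subgroup_subset_RG by blast
qed

end
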